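(* For all integers $n,m\geq 3$ there exist pairwise-disjoint sets $A_1,\dots,A_n$ with $|A_i|=m$ for each $i$ and $A_1\cup\dots\cup A_n=\{1,2,\dots,nm\}$ (a set of $n$ $m$-sided dice) which are non-transitive and balanced. That is, $P(A_i\succ A_{i+1})>\tfrac12$ for $1\le i\le n-1$ and $P(A_n\succ A_1)>\tfrac12$, and moreover $P(A_1\succ A_2)=P(A_2\succ A_3)=\dots=P(A_{n-1}\succ A_n)=P(A_n\succ A_1)$.
   Context: A set of $n$ $m$-sided dice is a collection of pairwise-disjoint sets $A_1,\dots,A_n$ with $|A_i|=m$ and $\bigcup_i A_i=\{1,\dots,nm\}$. Die $A_i$ is thought of as labeled with the elements of $A_i$, and each label is rolled with probability $1/m$. For two dice $A,B$, $P(A\succ B)$ denotes the probability that, when $A$ and $B$ are rolled independently, the number shown on $A$ exceeds the number shown on $B$; equivalently, $P(A\succ B)=|\{(a,b)\in A\times B: a>b\}|/m^2$. One writes $A\succ B$ if $P(A\succ B)>\tfrac12$. The set $A_1,\dots,A_n$ is non-transitive if $A_i\succ A_{i+1}$ for all $i<n$ and $A_n\succ A_1$. It is balanced if all the probabilities $P(A_i\succ A_{i+1})$ for $i<n$, together with $P(A_n\succ A_1)$, are equal. *)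

theory Defs
  imports "HOL-Probability.Probability"
begin

text \<open>A family of dice is indexed by \<open>1, \<dots>, n\<close>; the values of the index function
  outside \<open>{1..n}\<close> are irrelevant.\<close>

definition dice_set :: "nat \<Rightarrow> nat \<Rightarrow> (nat \<Rightarrow> nat set) \<Rightarrow> bool" where
  "dice_set n m A \<longleftrightarrow>
     disjoint_family_on A {1..n} \<and>
     (\<forall>i\<in>{1..n}. card (A i) = m) \<and>
     (\<Union>i\<in>{1..n}. A i) = {1..n * m}"

text \<open>The two dice are rolled independently, hence the product of the two uniform
  distributions. Meaningful for finite nonempty label sets only.\<close>

definition win_prob :: "nat set \<Rightarrow> nat set \<Rightarrow> real" where
  "win_prob A B = measure_pmf.prob (pair_pmf (pmf_of_set A) (pmf_of_set B)) {(a, b). a > b}"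

definition beats :: "nat set \<Rightarrow> nat set \<Rightarrow> bool"  (infix "\<succ>" 50) where
  "A \<succ> B \<longleftrightarrow> win_prob A B > 1 / 2"

definition nontransitive :: "nat \<Rightarrow> (nat \<Rightarrow> nat set) \<Rightarrow> bool" where
  "nontransitive n A \<longleftrightarrow> (\<forall>i\<in>{1..<n}. A i \<succ> A (i + 1)) \<and> A n \<succ> A 1"

definition balanced :: "nat \<Rightarrow> (nat \<Rightarrow> nat set) \<Rightarrow> bool" where
  "balanced n A \<longleftrightarrow>
     (\<exists>p. (\<forall>i\<in>{1..<n}. win_prob (A i) (A (i + 1)) = p) \<and> win_prob (A n) (A 1) = p)"

lemma win_prob_eq_card:
  assumes "card A = m" "card B = m" "m > 0"
  shows "win_prob A B = real (card {(a, b) \<in> A \<times> B. a > b}) / real m ^ 2"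
proof -
  have fin: "finite A" "A \<noteq> {}" "finite B" "B \<noteq> {}"
    using assms card_gt_0_iff[of A] card_gt_0_iff[of B] by simp_all
  have "pair_pmf (pmf_of_set A) (pmf_of_set B) = pmf_of_set (A \<times> B)"
    using fin
    by (intro pmf_eqI)
      (simp add: pmf_pair split_paired_all pmf_of_set[OF fin(2,1)] pmf_of_set[OF fin(4,3)]
        indicator_def card_cartesian_product)
  moreover have "A \<times> B \<inter> {(a, b). a > b} = {(a, b) \<in> A \<times> B. a > b}"
    by auto
  ultimately show ?thesis
    using fin assms
    by (simp add: win_prob_def measure_pmf_of_set card_cartesian_product power2_eq_square)
qed

end

theory Submission
  imports Defs
begin

text \<open>Append a block of \<open>n\<close> new largest labels to a set of \<open>m\<close>-sided dice, giving one to
  each die in an order described by a permutation \<open>p\<close>. Every win count \<open>w(A\<^sub>i, A\<^sub>j)\<close> grows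
  by \<open>m\<close>, and by one more if \<open>p i > p j\<close>. Hence appending an order and then its reverse adds two sides
  and preserves \<open>2 w - m\<^sup>2\<close>, and it suffices to treat \<open>m = 3\<close> and \<open>m = 4\<close>. For \<open>m \<le> n\<close> this is done
  with \<open>m\<close> permutations such that each of the \<open>n\<close> cyclic edges \<open>i \<rightarrow> i + 1\<close> is an ascent in
  exactly one of them. Each permutation must have at least one such ascent, so \<open>n = 3\<close>, \<open>m = 4\<close> needs
  a separate example.\<close>

section \<open>Win counts and blocks of new largest labels\<close>

definition wins :: "nat set \<Rightarrow> nat set \<Rightarrow> nat" where
  "wins A B = card {(a, b) \<in> A \<times> B. a > b}"

text \<open>Used with \<open>N = n * m\<close>, the largest label so far, and with \<open>p\<close>
  permuting \<open>{1..n}\<close>, so that the new labels are exactly the next \<open>n\<close>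
  integers.\<close>

definition add_block :: "nat \<Rightarrow> (nat \<Rightarrow> nat) \<Rightarrow> (nat \<Rightarrow> nat set) \<Rightarrow> nat \<Rightarrow> nat set" where
  "add_block N p A i = insert (N + p i) (A i)"

text \<open>Integer form of balance: for \<open>m\<close>-sided dice with \<open>m > 0\<close> the
  common probability is \<open>c / m ^ 2\<close>, so non-transitivity amounts to
  \<open>2 * c > m ^ 2\<close>.\<close>

definition cyclic_wins :: "nat \<Rightarrow> (nat \<Rightarrow> nat set) \<Rightarrow> nat \<Rightarrow> bool" where
  "cyclic_wins n A c \<longleftrightarrow> (\<forall>i\<in>{1..<n}. wins (A i) (A (i + 1)) = c) \<and> wins (A n) (A 1) = c"

lemma dice_set_subset:
  assumes "dice_set n m A" "i \<in> {1..n}"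
  shows "A i \<subseteq> {1..n * m}"
  using assms unfolding dice_set_def by blast

lemma wins_insert_top:
  assumes "A \<subseteq> {1..N}" "B \<subseteq> {1..N}" "x \<ge> 1" "y \<ge> 1"
  shows "wins (insert (N + x) A) (insert (N + y) B) = wins A B + card B + of_bool (x > y)"
proof -
  let ?W = "{(a, b) \<in> A \<times> B. a > b}" and ?T = "{N + x} \<times> B"
    and ?D = "if x > y then {(N + x, N + y)} else {}"
  have fin: "finite A" "finite B"
    using assms finite_subset by blast+
  then have finW: "finite ?W"
    by (auto intro: finite_subset[of _ "A \<times> B"])
  have A_le: "\<not> N + y < a" if "a \<in> A" for a
    using that assms by fastforce
  have B_less: "b < N + x" if "b \<in> B" for b
    using that assms by fastforce
  \<comment> \<open>Old wins, wins of the new top label over all old labels of \<open>B\<close>, and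
    the duel of the two new labels. An old label of \<open>A\<close> never beats
    \<open>N + y\<close>.\<close>
  have "{(a, b) \<in> insert (N + x) A \<times> insert (N + y) B. a > b} = (?W \<union> ?T) \<union> ?D"
    by (auto simp: A_le B_less)
  moreover have "card ((?W \<union> ?T) \<union> ?D) = card (?W \<union> ?T) + card ?D"
    using fin finW assms by (intro card_Un_disjoint) (auto split: if_splits)
  moreover have "card (?W \<union> ?T) = card ?W + card ?T"
    using fin finW assms by (intro card_Un_disjoint) auto
  ultimately show ?thesis
    by (simp add: wins_def card_cartesian_product)
qed

lemma wins_add_block:
  assumes "dice_set n m A" "p ` {1..n} = {1..n}" "i \<in> {1..n}" "j \<in> {1..n}"
  shows "wins (add_block (n * m) p A i) (add_block (n * m) p A j)
    = wins (A i) (A j) + m + of_bool (p i > p j)"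
proof -
  have "p i \<ge> 1" "p j \<ge> 1"
    using assms by (metis atLeastAtMost_iff imageI)+
  moreover have "card (A j) = m"
    using assms by (simp add: dice_set_def)
  ultimately show ?thesis
    using wins_insert_top dice_set_subset assms by (simp add: add_block_def)
qed

text \<open>The new labels lie above all old ones and are distinct, since a surjection of a finite
  set onto itself is injective.\<close>

lemma dice_set_add_block:
  assumes A: "dice_set n m A" and p: "p ` {1..n} = {1..n}"
  shows "dice_set n (Suc m) (add_block (n * m) p A)"
proof -
  have inj: "inj_on p {1..n}"
    using p by (simp add: eq_card_imp_inj_on)
  have pos: "p i \<ge> 1" if "i \<in> {1..n}" for i
    using that p by fastforce
  have fresh: "n * m + p i \<notin> A j" if "i \<in> {1..n}" "j \<in> {1..n}" for i j
    using pos[OF that(1)] subsetD[OF dice_set_subset[OF A that(2)], of "n * m + p i"] by fastforce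
  have "disjoint_family_on (add_block (n * m) p A) {1..n}"
    unfolding disjoint_family_on_def
  proof (intro ballI impI)
    fix i j assume ij: "i \<in> {1..n}" "j \<in> {1..n}" "i \<noteq> j"
    have "p i \<noteq> p j"
      using inj_on_eq_iff[OF inj ij(1,2)] ij(3) by simp
    moreover have "A i \<inter> A j = {}"
      using A ij unfolding dice_set_def disjoint_family_on_def by blast
    ultimately show "add_block (n * m) p A i \<inter> add_block (n * m) p A j = {}"
      using fresh[of i j] fresh[of j i] ij by (simp add: add_block_def)
  qed
  moreover have "card (add_block (n * m) p A i) = Suc m" if "i \<in> {1..n}" for i
  proof -
    have "finite (A i)"
      using dice_set_subset[OF A that] finite_subset by blast
    then show ?thesis
      using fresh[OF that that] A that by (simp add: add_block_def dice_set_def)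
  qed
  moreover have "(\<Union>i\<in>{1..n}. add_block (n * m) p A i) = {1..n * Suc m}"
  proof -
    have "(\<Union>i\<in>{1..n}. add_block (n * m) p A i) = (+) (n * m) ` p ` {1..n} \<union> (\<Union>i\<in>{1..n}. A i)"
      by (auto simp: add_block_def)
    also have "\<dots> = {1 + n * m..n + n * m} \<union> {1..n * m}"
      using A p by (simp add: dice_set_def add.commute)
    also have "\<dots> = {1..n * Suc m}"
      by auto
    finally show ?thesis .
  qed
  ultimately show ?thesis
    by (simp add: dice_set_def)
qed

lemma dice_set_empty: "dice_set n 0 (\<lambda>_. {})"
  by (simp add: dice_set_def disjoint_family_on_def)

lemma perm_image:
  fixes p :: "nat \<Rightarrow> nat"
  assumes "inj_on p {1..n}" "p ` {1..n} \<subseteq> {1..n}"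
  shows "p ` {1..n} = {1..n}"
  using assms by (simp add: endo_inj_surj)

lemma add_two_sides:
  assumes "dice_set n m A" "cyclic_wins n A c" "n \<ge> 2"
  shows "\<exists>B. dice_set n (m + 2) B \<and> cyclic_wins n B (c + 2 * m + 2)"
proof -
  define A' where "A' = add_block (n * m) (\<lambda>i. i) A"
  define B where "B = add_block (n * Suc m) (\<lambda>i. n + 1 - i) A'"
  have rev: "(\<lambda>i. n + 1 - i) ` {1..n} = {1..n}"
    by (rule perm_image) (auto simp: inj_on_def)
  have A': "dice_set n (Suc m) A'"
    unfolding A'_def by (rule dice_set_add_block[OF assms(1)]) simp
  have "dice_set n (m + 2) B"
    using dice_set_add_block[OF A' rev] by (simp add: B_def)
  \<comment> \<open>The two blocks contribute \<open>m\<close> and \<open>m + 1\<close>. As their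
    orders are opposite, exactly one of them also makes the new label of \<open>i\<close> exceed
    that of \<open>j\<close>.\<close>
  moreover have "wins (B i) (B j) = wins (A i) (A j) + 2 * m + 2"
    if "i \<in> {1..n}" "j \<in> {1..n}" "i \<noteq> j" for i j
    using that unfolding B_def
    by (subst wins_add_block[OF A' rev that(1,2)])
      (auto simp: A'_def wins_add_block[OF assms(1)])
  ultimately show ?thesis
    using assms(2,3) by (intro exI[of _ B]) (auto simp: cyclic_wins_def)
qed

section \<open>Base cases: three and four sides\<close>

lemma three_sided_dice:
  assumes "n \<ge> 3"
  shows "\<exists>A. dice_set n 3 A \<and> cyclic_wins n A 5"
proof -
  \<comment> \<open>The value sequences are \<open>n, ..., 1\<close>, then
    \<open>1, n, ..., 2\<close>, then \<open>2, 1, 3, ..., n\<close>. Their cyclic ascents are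
    respectively the edge from \<open>n\<close> to \<open>1\<close>, the edge from \<open>1\<close>
    to \<open>2\<close>, and all remaining edges.\<close>
  define p1 where "p1 = (\<lambda>i. n + 1 - i)"
  define p2 where "p2 = (\<lambda>i. if i = 1 then 1 else n + 2 - i)"
  define p3 where "p3 = (\<lambda>i::nat. if i = 1 then 2 else if i = 2 then 1 else i)"
  define A1 where "A1 = add_block (n * 0) p1 (\<lambda>_. {})"
  define A2 where "A2 = add_block (n * Suc 0) p2 A1"
  define A3 where "A3 = add_block (n * Suc (Suc 0)) p3 A2"
  have p: "p1 ` {1..n} = {1..n}" "p2 ` {1..n} = {1..n}" "p3 ` {1..n} = {1..n}"
    using assms by (intro perm_image; auto simp: inj_on_def p1_def p2_def p3_def split: if_splits)+
  have d1: "dice_set n (Suc 0) A1"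
    unfolding A1_def by (rule dice_set_add_block[OF dice_set_empty p(1)])
  have d2: "dice_set n (Suc (Suc 0)) A2"
    unfolding A2_def by (rule dice_set_add_block[OF d1 p(2)])
  have d3: "dice_set n 3 A3"
    unfolding A3_def numeral_3_eq_3 by (rule dice_set_add_block[OF d2 p(3)])
  \<comment> \<open>The constant is \<open>0 + 1 + 2\<close>, the numbers of sides before each
    block. Each cyclic edge descends in exactly two permutations, giving
    \<open>3 + 2 = 5\<close>.\<close>
  have w: "wins (A3 i) (A3 j)
      = 3 + of_bool (p1 i > p1 j) + of_bool (p2 i > p2 j) + of_bool (p3 i > p3 j)"
    if "i \<in> {1..n}" "j \<in> {1..n}" for i j
    unfolding A3_def wins_add_block[OF d2 p(3) that]
    unfolding A2_def wins_add_block[OF d1 p(2) that]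
    unfolding A1_def wins_add_block[OF dice_set_empty p(1) that]
    by (simp add: wins_def)
  have "wins (A3 i) (A3 (i + 1)) = 5" if "i \<in> {1..<n}" for i
  proof -
    have "i \<ge> 1"
      using that by simp
    then consider "i = 1" | "i = 2" | "i \<ge> 3"
      by linarith
    then show ?thesis
      using that assms by cases (simp_all add: w p1_def p2_def p3_def, arith+)
  qed
  moreover have "wins (A3 n) (A3 1) = 5"
    using assms by (simp add: w p1_def p2_def p3_def)
  ultimately have "cyclic_wins n A3 5"
    by (simp add: cyclic_wins_def)
  then show ?thesis
    using d3 by blast
qed

lemma four_sided_dice_ge4:
  assumes "n \<ge> 4"
  shows "\<exists>A. dice_set n 4 A \<and> cyclic_wins n A 9"
proof -
  \<comment> \<open>Now \<open>p3\<close> is \<open>2, 1, n, ..., 4, 3\<close>, with the edge from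
    \<open>2\<close> to \<open>3\<close> as its only cyclic ascent. The edges from \<open>i\<close>
    to \<open>i + 1\<close> with \<open>3 \<le> i < n\<close> are left to \<open>p4\<close>, which
    is \<open>3, 2, 1, 4, ..., n\<close>; the edge from \<open>n\<close> to \<open>1\<close> is a
    descent of \<open>p4\<close> because \<open>n \<ge> 4\<close>.\<close>
  define p1 where "p1 = (\<lambda>i. n + 1 - i)"
  define p2 where "p2 = (\<lambda>i. if i = 1 then 1 else n + 2 - i)"
  define p3 where "p3 = (\<lambda>i::nat. if i = 1 then 2 else if i = 2 then 1 else n + 3 - i)"
  define p4 where "p4 = (\<lambda>i::nat. if i \<le> 3 then 4 - i else i)"
  define A1 where "A1 = add_block (n * 0) p1 (\<lambda>_. {})"
  define A2 where "A2 = add_block (n * Suc 0) p2 A1"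
  define A3 where "A3 = add_block (n * Suc (Suc 0)) p3 A2"
  define A4 where "A4 = add_block (n * Suc (Suc (Suc 0))) p4 A3"
  have p: "p1 ` {1..n} = {1..n}" "p2 ` {1..n} = {1..n}" "p3 ` {1..n} = {1..n}" "p4 ` {1..n} = {1..n}"
    using assms
    by (intro perm_image; auto simp: inj_on_def p1_def p2_def p3_def p4_def split: if_splits)+
  have d1: "dice_set n (Suc 0) A1"
    unfolding A1_def by (rule dice_set_add_block[OF dice_set_empty p(1)])
  have d2: "dice_set n (Suc (Suc 0)) A2"
    unfolding A2_def by (rule dice_set_add_block[OF d1 p(2)])
  have d3: "dice_set n (Suc (Suc (Suc 0))) A3"
    unfolding A3_def by (rule dice_set_add_block[OF d2 p(3)])
  have d4: "dice_set n 4 A4"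
    using dice_set_add_block[OF d3 p(4)] by (simp add: A4_def eval_nat_numeral)
  \<comment> \<open>Here the constant is \<open>0 + 1 + 2 + 3\<close>, and each cyclic edge descends
    in three of the four permutations, giving \<open>6 + 3 = 9\<close>.\<close>
  have w: "wins (A4 i) (A4 j)
      = 6 + of_bool (p1 i > p1 j) + of_bool (p2 i > p2 j) + of_bool (p3 i > p3 j) + of_bool (p4 i > p4 j)"
    if "i \<in> {1..n}" "j \<in> {1..n}" for i j
    unfolding A4_def wins_add_block[OF d3 p(4) that]
    unfolding A3_def wins_add_block[OF d2 p(3) that]
    unfolding A2_def wins_add_block[OF d1 p(2) that]
    unfolding A1_def wins_add_block[OF dice_set_empty p(1) that]
    by (simp add: wins_def)
  have "wins (A4 i) (A4 (i + 1)) = 9" if "i \<in> {1..<n}" for i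
  proof -
    have "i \<ge> 1"
      using that by simp
    then consider "i = 1" | "i = 2" | "i = 3" | "i \<ge> 4"
      by linarith
    then show ?thesis
      using that assms by cases (simp_all add: w p1_def p2_def p3_def p4_def, arith+)
  qed
  moreover have "wins (A4 n) (A4 1) = 9"
    using assms by (simp add: w p1_def p2_def p3_def p4_def)
  ultimately have "cyclic_wins n A4 9"
    by (simp add: cyclic_wins_def)
  then show ?thesis
    using d4 by blast
qed

text \<open>Turns the count into a sum that simplification can evaluate on explicit sets.\<close>

lemma wins_eq_sum:
  assumes "finite A" "finite B"
  shows "wins A B = (\<Sum>a\<in>A. \<Sum>b\<in>B. of_bool (a > b))"
proof -
  have "{(a, b) \<in> A \<times> B. a > b} = (SIGMA a:A. {b \<in> B. a > b})"
    by auto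
  then show ?thesis
    using assms by (simp add: wins_def sum.If_cases of_bool_def Int_def)
qed

lemma three_four_sided_dice: "\<exists>A. dice_set 3 4 A \<and> cyclic_wins 3 A 9"
proof -
  define A :: "nat \<Rightarrow> nat set" where
    "A = (\<lambda>i. if i = 1 then {1, 3, 10, 12} else if i = 2 then {2, 7, 8, 9} else {4, 5, 6, 11})"
  have index: "{1..3::nat} = {1, 2, 3}" "{1..<3::nat} = {1, 2}"
    by auto
  have labels: "{1..3 * 4::nat} = {1, 2, 3, 4, 5, 6, 7, 8, 9, 10, 11, 12}"
    by (auto; presburger)
  have "dice_set 3 4 A"
    unfolding dice_set_def disjoint_family_on_def index labels by (auto simp: A_def)
  moreover have "cyclic_wins 3 A 9"
    by (simp add: cyclic_wins_def index A_def wins_eq_sum)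
  ultimately show ?thesis
    by blast
qed

lemma four_sided_dice:
  assumes "n \<ge> 3"
  shows "\<exists>A. dice_set n 4 A \<and> cyclic_wins n A 9"
proof (cases "n = 3")
  case True
  then show ?thesis
    using three_four_sided_dice by simp
next
  case False
  then show ?thesis
    using four_sided_dice_ge4 assms by simp
qed

section \<open>Induction on the number of sides\<close>

lemma cyclic_dice:
  assumes "n \<ge> 3" "m \<ge> 3"
  shows "\<exists>A c. dice_set n m A \<and> cyclic_wins n A c \<and> 2 * c > m ^ 2"
  using assms(2)
proof (induction m rule: less_induct)
  case (less m)
  \<comment> \<open>The inductive step adds two sides, so each parity needs its own base case; there
    \<open>2 * 5 > 9\<close> and \<open>2 * 9 > 16\<close>.\<close>
  consider "m = 3" | "m = 4" | "m \<ge> 5"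
    using less.prems by linarith
  then show ?case
  proof cases
    case 1
    obtain A where "dice_set n 3 A" "cyclic_wins n A 5"
      using three_sided_dice[OF assms(1)] by blast
    then show ?thesis
      using 1 by (intro exI[of _ A] exI[of _ 5]) simp
  next
    case 2
    obtain A where "dice_set n 4 A" "cyclic_wins n A 9"
      using four_sided_dice[OF assms(1)] by blast
    then show ?thesis
      using 2 by (intro exI[of _ A] exI[of _ 9]) simp
  next
    case 3
    define k where "k = m - 2"
    have k: "m = k + 2" "k < m" "k \<ge> 3"
      using 3 by (simp_all add: k_def)
    obtain A c where "dice_set n k A" "cyclic_wins n A c" and c: "2 * c > k ^ 2"
      using less.IH[OF k(2,3)] by blast
    then obtain B where "dice_set n m B" "cyclic_wins n B (c + 2 * k + 2)"
      using add_two_sides[of n k A c] assms(1) k(1) by auto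
    \<comment> \<open>Both sides exceed those of the hypothesis \<open>c\<close> by
      \<open>4 * k + 4\<close>, so the margin is unchanged.\<close>
    moreover have "2 * (c + 2 * k + 2) > m ^ 2"
      using c by (simp add: k(1) power2_eq_square algebra_simps)
    ultimately show ?thesis
      by blast
  qed
qed

theorem theorem2:
  fixes n m :: nat
  assumes "n \<ge> 3" and "m \<ge> 3"
  shows "\<exists>A :: nat \<Rightarrow> nat set. dice_set n m A \<and> nontransitive n A \<and> balanced n A"
proof -
  obtain A c where A: "dice_set n m A" and wins: "cyclic_wins n A c" and c: "2 * c > m ^ 2"
    using cyclic_dice[OF assms] by blast
  have prob: "win_prob (A i) (A j) = real (wins (A i) (A j)) / real m ^ 2"
    if "i \<in> {1..n}" "j \<in> {1..n}" for i j
    using A that assms unfolding wins_def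
    by (intro win_prob_eq_card) (auto simp: dice_set_def)
  have edges: "\<forall>i\<in>{1..<n}. win_prob (A i) (A (i + 1)) = real c / real m ^ 2"
    "win_prob (A n) (A 1) = real c / real m ^ 2"
    using wins assms(1) by (auto simp: cyclic_wins_def prob)
  have "real m ^ 2 < 2 * real c"
    using c by (metis of_nat_less_iff of_nat_mult of_nat_numeral of_nat_power)
  then have "real c / real m ^ 2 > 1 / 2"
    using assms(2) by (simp add: field_simps)
  then have "nontransitive n A"
    using edges by (simp add: nontransitive_def beats_def)
  moreover have "balanced n A"
    using edges by (auto simp: balanced_def)
  ultimately show ?thesis
    using A by blast
qed

end
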